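(* The even part of the Weyl group of the hyperbolic Kac--Moody algebra $A_2^{++}$ is $$W^+(A_2^{++})\cong PSL_2(\mathtt{E}),$$ where $\mathtt{E}=\mathbb{Z}[e^{2\pi i/3}]$ is the ring of Eisenstein integers and $PSL_2(\mathtt{E})$ is the subgroup of $PSL_2(\mathbb{C})$ obtained by restricting all entries to be Eisenstein integers.
   Context: For a Kac--Moody algebra with Cartan matrix $[A_{IJ}]$, the Weyl group $W$ is the Coxeter group with generators $w_I$ and relations $w_I^2=1$, $(w_Iw_J)^{m_{IJ}}=1$ for $I\ne J$, where $m_{IJ}=2,3,4,6,\infty$ according as $A_{IJ}A_{JI}=0,1,2,3,\ge4$. $W^+\subset W$ is the index 2 subgroup of products of an even number of generators. $A_2^{++}$ is the over-extension of $A_2$ (the untwisted affine extension $A_2^{(1)}$ with one more node attached by a single line to the affine node). Its nodes are $-1,0,1,2$ and its Dynkin diagram has exactly the single edges $\{-1,0\},\{0,1\},\{0,2\},\{1,2\}$, i.e. $m_{IJ}=3$ for these pairs and $m_{IJ}=2$ for all other pairs of distinct nodes. $PSL_2(\mathtt{E})=SL_2(\mathtt{E})/\{\pm1\}$, where $SL_2(\mathtt{E})$ is the group of $2\times2$ matrices with entries in $\mathtt{E}$ and determinant $1$. *)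

theory Defs
  imports
    "HOL-Analysis.Analysis"
    "HOL-Algebra.Coset"
    "HOL-Library.Extended_Nat"
    "HOL-Computational_Algebra.Polynomial"
begin

text \<open>
  A word is a list of letters; \<open>(a, True)\<close> stands for the generator \<open>a\<close> and \<open>(a, False)\<close> for its
  formal inverse. All elements of the type \<open>'a\<close> are generators, and the relators \<open>R\<close> are the words
  that are set equal to \<open>1\<close>.
\<close>

type_synonym 'a word = "('a \<times> bool) list"

inductive word_eq :: "'a word set \<Rightarrow> 'a word \<Rightarrow> 'a word \<Rightarrow> bool" for R where
  refl: "word_eq R u u"
| sym: "word_eq R u v \<Longrightarrow> word_eq R v u"
| trans: "word_eq R u v \<Longrightarrow> word_eq R v w \<Longrightarrow> word_eq R u w"
| append: "word_eq R u u' \<Longrightarrow> word_eq R v v' \<Longrightarrow> word_eq R (u @ v) (u' @ v')"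
| cancel: "word_eq R [(a, b), (a, \<not> b)] []"
| relator: "r \<in> R \<Longrightarrow> word_eq R r []"

definition word_class :: "'a word set \<Rightarrow> 'a word \<Rightarrow> 'a word set" where
  "word_class R u = {v. word_eq R u v}"

definition presented_group :: "'a word set \<Rightarrow> 'a word set monoid" where
  "presented_group R =
     \<lparr>carrier = range (word_class R),
      monoid.mult = (\<lambda>X Y. {w. \<exists>x\<in>X. \<exists>y\<in>Y. word_eq R (x @ y) w}),
      one = word_class R []\<rparr>"

lemma word_class_eq_iff: "word_class R u = word_class R v \<longleftrightarrow> word_eq R u v"
  by (auto simp: word_class_def intro: word_eq.refl word_eq.sym word_eq.trans)

lemma carrier_presented_group: "carrier (presented_group R) = range (word_class R)"
  by (simp add: presented_group_def)

lemma one_presented_group: "\<one>\<^bsub>presented_group R\<^esub> = word_class R []"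
  by (simp add: presented_group_def)

lemma mult_presented_group:
  "word_class R u \<otimes>\<^bsub>presented_group R\<^esub> word_class R v = word_class R (u @ v)"
  by (auto simp: presented_group_def word_class_def
        intro: word_eq.refl word_eq.trans word_eq.append)

lemma word_eq_inverse: "word_eq R (rev (map (\<lambda>(a, b). (a, \<not> b)) u) @ u) []"
proof (induction u)
  case Nil
  show ?case by (simp add: word_eq.refl)
next
  case (Cons p u)
  obtain a b where p: "p = (a, b)" by fastforce
  have "word_eq R [(a, \<not> b), (a, b)] []"
    using word_eq.cancel[of R a "\<not> b"] by simp
  from word_eq.append[OF word_eq.refl word_eq.append[OF this word_eq.refl]]
  have "word_eq R (rev (map (\<lambda>(a, b). (a, \<not> b)) u) @ ([(a, \<not> b), (a, b)] @ u))
      (rev (map (\<lambda>(a, b). (a, \<not> b)) u) @ ([] @ u))" .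
  with Cons.IH show ?case
    by (auto simp: p intro: word_eq.trans)
qed

lemma group_presented_group: "group (presented_group R)"
proof (rule groupI)
  fix X assume "X \<in> carrier (presented_group R)"
  then obtain u where "X = word_class R u"
    by (auto simp: carrier_presented_group)
  then show "\<exists>Y\<in>carrier (presented_group R). Y \<otimes>\<^bsub>presented_group R\<^esub> X = \<one>\<^bsub>presented_group R\<^esub>"
    by (intro bexI[of _ "word_class R (rev (map (\<lambda>(a, b). (a, \<not> b)) u))"])
       (auto simp: carrier_presented_group one_presented_group mult_presented_group
          word_class_eq_iff word_eq_inverse)
qed (auto simp: carrier_presented_group one_presented_group mult_presented_group)

text \<open>
  For distinct nodes of a generalized Cartan matrix \<open>p \<ge> 0\<close>, so the last case is \<open>p \<ge> 4\<close>. The exponent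
  \<open>\<infinity>\<close> contributes no relator.
\<close>

definition coxeter_exponent :: "('i \<Rightarrow> 'i \<Rightarrow> int) \<Rightarrow> 'i \<Rightarrow> 'i \<Rightarrow> enat" where
  "coxeter_exponent A i j =
     (let p = A i j * A j i in
      if p = 0 then 2 else if p = 1 then 3 else if p = 2 then 4 else if p = 3 then 6 else \<infinity>)"

definition weyl_relators :: "('i \<Rightarrow> 'i \<Rightarrow> int) \<Rightarrow> 'i word set" where
  "weyl_relators A =
     {[(i, True), (i, True)] | i. True} \<union>
     {concat (replicate n [(i, True), (j, True)]) | i j n.
        i \<noteq> j \<and> coxeter_exponent A i j = enat n}"

definition weyl_group :: "('i \<Rightarrow> 'i \<Rightarrow> int) \<Rightarrow> 'i word set monoid" where
  "weyl_group A = presented_group (weyl_relators A)"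

definition weyl_gen :: "('i \<Rightarrow> 'i \<Rightarrow> int) \<Rightarrow> 'i \<Rightarrow> 'i word set" where
  "weyl_gen A i = word_class (weyl_relators A) [(i, True)]"

definition weyl_prod :: "('i \<Rightarrow> 'i \<Rightarrow> int) \<Rightarrow> 'i list \<Rightarrow> 'i word set" where
  "weyl_prod A is = foldr (\<lambda>i x. weyl_gen A i \<otimes>\<^bsub>weyl_group A\<^esub> x) is \<one>\<^bsub>weyl_group A\<^esub>"

definition even_weyl_group :: "('i \<Rightarrow> 'i \<Rightarrow> int) \<Rightarrow> 'i word set monoid" where
  "even_weyl_group A = (weyl_group A)\<lparr>carrier := {weyl_prod A is | is. even (length is)}\<rparr>"

lemma group_weyl_group: "group (weyl_group A)"
  by (simp add: weyl_group_def group_presented_group)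

lemma weyl_prod_eq: "weyl_prod A is = word_class (weyl_relators A) (map (\<lambda>i. (i, True)) is)"
  by (induction "is")
     (simp_all add: weyl_prod_def weyl_gen_def weyl_group_def one_presented_group
        mult_presented_group)

lemma weyl_relators_even: "r \<in> weyl_relators A \<Longrightarrow> even (length r)"
  by (auto simp: weyl_relators_def length_concat sum_list_replicate)

lemma word_eq_parity:
  "word_eq (weyl_relators A) u v \<Longrightarrow> even (length u) \<longleftrightarrow> even (length v)"
  by (induction rule: word_eq.induct) (auto dest: weyl_relators_even)

lemma word_eq_positive:
  "word_eq (weyl_relators A) u (map (\<lambda>i. (i, True)) (map fst u))"
proof (induction u)
  case Nil
  show ?case by (simp add: word_eq.refl)
next
  case (Cons p u)
  let ?R = "weyl_relators A"
  obtain i b where p: "p = (i, b)" by fastforce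
  have "word_eq ?R [(i, b)] [(i, True)]"
  proof (cases b)
    case False
    have "word_eq ?R ([(i, False)] @ [(i, True), (i, True)]) ([(i, False)] @ [])"
      by (intro word_eq.append word_eq.refl word_eq.relator) (auto simp: weyl_relators_def)
    moreover have "word_eq ?R ([(i, False), (i, True)] @ [(i, True)]) ([] @ [(i, True)])"
      using word_eq.append[OF word_eq.cancel[of ?R i False] word_eq.refl] by simp
    ultimately show ?thesis
      using False by (auto intro: word_eq.sym word_eq.trans)
  qed (simp add: word_eq.refl)
  from word_eq.append[OF this Cons.IH] show ?case
    by (simp add: p)
qed

lemma carrier_weyl_group: "carrier (weyl_group A) = range (weyl_prod A)"
proof -
  have "word_class (weyl_relators A) u = weyl_prod A (map fst u)" for u
    unfolding weyl_prod_eq word_class_eq_iff by (rule word_eq_positive)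
  then have "range (word_class (weyl_relators A)) \<subseteq> range (weyl_prod A)"
    by (metis image_subsetI rangeI)
  moreover have "range (weyl_prod A) \<subseteq> range (word_class (weyl_relators A))"
    by (auto simp: weyl_prod_eq)
  ultimately show ?thesis
    by (simp add: weyl_group_def carrier_presented_group)
qed

lemma weyl_prod_append:
  "weyl_prod A is \<otimes>\<^bsub>weyl_group A\<^esub> weyl_prod A js = weyl_prod A (is @ js)"
  by (simp add: weyl_prod_eq weyl_group_def mult_presented_group)

lemma weyl_prod_parity:
  "weyl_prod A is = weyl_prod A js \<Longrightarrow> even (length is) \<longleftrightarrow> even (length js)"
  by (auto simp: weyl_prod_eq word_class_eq_iff dest: word_eq_parity)

lemma weyl_prod_rev: "weyl_prod A (rev js @ js) = weyl_prod A []"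
proof (induction js)
  case (Cons j js)
  have "word_eq (weyl_relators A) [(j, True), (j, True)] []"
    by (rule word_eq.relator) (auto simp: weyl_relators_def)
  then have "weyl_prod A [j, j] = weyl_prod A []"
    by (simp add: weyl_prod_eq word_class_eq_iff)
  then have "weyl_prod A (rev js @ [j, j] @ js) = weyl_prod A (rev js @ [] @ js)"
    by (simp only: weyl_prod_append[symmetric])
  with Cons show ?case by simp
qed simp

lemma subgroup_even_weyl_group: "subgroup (carrier (even_weyl_group A)) (weyl_group A)"
proof -
  interpret group "weyl_group A" by (rule group_weyl_group)
  have H: "carrier (even_weyl_group A) = {weyl_prod A is | is. even (length is)}"
    by (simp add: even_weyl_group_def)
  have inv_prod: "inv\<^bsub>weyl_group A\<^esub> weyl_prod A is = weyl_prod A (rev is)" for "is"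
    by (rule inv_equality)
       (simp_all add: weyl_prod_append weyl_prod_rev carrier_weyl_group, simp add: weyl_prod_def)
  show ?thesis
  proof (rule subgroupI)
    show "carrier (even_weyl_group A) \<subseteq> carrier (weyl_group A)"
      by (auto simp: H carrier_weyl_group)
    have "weyl_prod A [] \<in> carrier (even_weyl_group A)"
      unfolding H by (intro CollectI exI[of _ "[]"]) simp
    then show "carrier (even_weyl_group A) \<noteq> {}" by blast
  next
    fix x assume "x \<in> carrier (even_weyl_group A)"
    then obtain js where js: "x = weyl_prod A js" "even (length js)" unfolding H by blast
    then show "inv\<^bsub>weyl_group A\<^esub> x \<in> carrier (even_weyl_group A)"
      unfolding H by (intro CollectI exI[of _ "rev js"]) (simp add: inv_prod)
  next
    fix x y assume "x \<in> carrier (even_weyl_group A)" "y \<in> carrier (even_weyl_group A)"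
    then obtain js ks where js: "x = weyl_prod A js" "y = weyl_prod A ks"
      "even (length js)" "even (length ks)" unfolding H by blast
    then show "x \<otimes>\<^bsub>weyl_group A\<^esub> y \<in> carrier (even_weyl_group A)"
      unfolding H by (intro CollectI exI[of _ "js @ ks"]) (simp add: weyl_prod_append)
  qed
qed

lemma index_even_weyl_group:
  "card (rcosets\<^bsub>weyl_group A\<^esub> (carrier (even_weyl_group A))) = 2"
proof -
  interpret group "weyl_group A" by (rule group_weyl_group)
  let ?H = "carrier (even_weyl_group A)"
  let ?O = "{weyl_prod A is | is. odd (length is)}"
  have H: "?H = {weyl_prod A is | is. even (length is)}"
    by (simp add: even_weyl_group_def)
  have coset: "?H #>\<^bsub>weyl_group A\<^esub> weyl_prod A js = (if even (length js) then ?H else ?O)"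
    for js
  proof -
    have sub: "?H #>\<^bsub>weyl_group A\<^esub> weyl_prod A js
        = {weyl_prod A (is @ js) | is. even (length is)}"
      by (auto simp: H r_coset_def weyl_prod_append)
    have id: "weyl_prod A ks = weyl_prod A ((ks @ rev js) @ js)" for ks
    proof -
      have "weyl_prod A (ks @ (rev js @ js)) = weyl_prod A (ks @ [])"
        by (simp only: weyl_prod_append[symmetric] weyl_prod_rev[unfolded weyl_prod_append[symmetric]])
      then show ?thesis by simp
    qed
    show ?thesis
    proof (intro subset_antisym subsetI)
      fix x assume "x \<in> ?H #>\<^bsub>weyl_group A\<^esub> weyl_prod A js"
      then obtain ks where "x = weyl_prod A (ks @ js)" "even (length ks)"
        unfolding sub by blast
      moreover from this have "even (length (ks @ js)) \<longleftrightarrow> even (length js)" by simp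
      ultimately show "x \<in> (if even (length js) then ?H else ?O)"
        unfolding H by auto
    next
      fix x assume "x \<in> (if even (length js) then ?H else ?O)"
      then obtain ks where "x = weyl_prod A ks" "even (length ks) \<longleftrightarrow> even (length js)"
        by (auto simp: H split: if_splits)
      then show "x \<in> ?H #>\<^bsub>weyl_group A\<^esub> weyl_prod A js"
        unfolding sub by (intro CollectI exI[of _ "ks @ rev js"] conjI)
          (use id[of ks] in simp_all)
    qed
  qed
  have rcos: "rcosets\<^bsub>weyl_group A\<^esub> ?H = {?H, ?O}"
  proof -
    have "rcosets\<^bsub>weyl_group A\<^esub> ?H = range (\<lambda>js. ?H #>\<^bsub>weyl_group A\<^esub> weyl_prod A js)"
      by (auto simp: RCOSETS_def carrier_weyl_group)
    also have "\<dots> = range (\<lambda>js :: 'a list. if even (length js) then ?H else ?O)"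
      by (simp only: coset)
    also have "\<dots> = {?H, ?O}"
    proof (intro subset_antisym)
      show "{?H, ?O} \<subseteq> range (\<lambda>js :: 'a list. if even (length js) then ?H else ?O)"
      proof (intro insert_subsetI empty_subsetI)
        show "?H \<in> range (\<lambda>js :: 'a list. if even (length js) then ?H else ?O)"
          by (rule range_eqI[of _ _ "[]"]) simp
        show "?O \<in> range (\<lambda>js :: 'a list. if even (length js) then ?H else ?O)"
          by (rule range_eqI[of _ _ "[undefined]"]) simp
      qed
    qed (simp add: image_subset_iff)
    finally show ?thesis .
  qed
  have "?H \<noteq> ?O"
  proof
    assume "?H = ?O"
    moreover have "weyl_prod A [] \<in> ?H" by (auto simp: H)
    ultimately show False by (auto dest: weyl_prod_parity)
  qed
  then have "card {?H, ?O} = 2" by simp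
  with rcos show ?thesis by simp
qed

text \<open>
  The constructors are the nodes \<open>-1\<close> (over-extended), \<open>0\<close> (affine), \<open>1\<close> and \<open>2\<close>, in this order.
\<close>

datatype A2pp_node = Nm1 | N0 | N1 | N2

definition A2pp_edges :: "A2pp_node set set" where
  "A2pp_edges = {{Nm1, N0}, {N0, N1}, {N0, N2}, {N1, N2}}"

definition A2pp_cartan :: "A2pp_node \<Rightarrow> A2pp_node \<Rightarrow> int" where
  "A2pp_cartan i j = (if i = j then 2 else if {i, j} \<in> A2pp_edges then -1 else 0)"

lemma coxeter_exponent_A2pp:
  "i \<noteq> j \<Longrightarrow> coxeter_exponent A2pp_cartan i j = (if {i, j} \<in> A2pp_edges then 3 else 2)"
  by (simp add: coxeter_exponent_def A2pp_cartan_def insert_commute)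

definition eisenstein_ints :: "complex set" where
  "eisenstein_ints = range (\<lambda>p :: int poly. poly (map_poly of_int p) (cis (2 * pi / 3)))"

definition SL2 :: "complex set \<Rightarrow> (complex^2^2) monoid" where
  "SL2 R = \<lparr>carrier = {M. (\<forall>i j. M $ i $ j \<in> R) \<and> det M = 1},
            monoid.mult = (**), one = mat 1\<rparr>"

definition PSL2 :: "complex set \<Rightarrow> (complex^2^2) set monoid" where
  "PSL2 R = SL2 R Mod {mat 1, - mat 1}"

lemma eisenstein_ints_eq:
  "eisenstein_ints = {of_int a + of_int b * cis (2 * pi / 3) | a b. True}"
proof -
  define w where "w = cis (2 * pi / 3)"
  have w2: "w * w = - 1 - w"
  proof -
    have "w * w * w = 1"
      by (simp add: w_def cis_mult)
    then have "(w - 1) * (w * w + w + 1) = 0"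
      by (simp add: algebra_simps)
    moreover have "w \<noteq> 1"
      by (simp add: w_def complex_eq_iff cos_120)
    ultimately have "w * w + w + 1 = 0" by simp
    then show ?thesis by (simp add: algebra_simps add_eq_0_iff)
  qed
  have "\<exists>a b. poly (map_poly of_int p) w = of_int a + of_int b * w" for p :: "int poly"
  proof (induction p)
    case 0
    show ?case by (intro exI[of _ 0]) simp
  next
    case (pCons c p)
    then obtain a b where "poly (map_poly of_int p) w = of_int a + of_int b * w" by blast
    then have "poly (map_poly of_int (pCons c p)) w = of_int c + w * (of_int a + of_int b * w)"
      using pCons by (simp add: map_poly_pCons)
    also have "\<dots> = of_int c + of_int a * w + of_int b * (w * w)"
      by (simp add: algebra_simps)
    also have "\<dots> = of_int (c - b) + of_int (a - b) * w"
      by (simp add: w2 algebra_simps)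
    finally show ?case by blast
  qed
  moreover have "of_int a + of_int b * w = poly (map_poly of_int [:a, b:]) w" for a b
    by (simp add: map_poly_pCons mult.commute)
  ultimately show ?thesis
    unfolding eisenstein_ints_def w_def[symmetric] image_def by blast
qed

lemma eisenstein_ints_closed:
  "0 \<in> eisenstein_ints" "1 \<in> eisenstein_ints"
  "x \<in> eisenstein_ints \<Longrightarrow> - x \<in> eisenstein_ints"
  "x \<in> eisenstein_ints \<Longrightarrow> y \<in> eisenstein_ints \<Longrightarrow> x + y \<in> eisenstein_ints"
  "x \<in> eisenstein_ints \<Longrightarrow> y \<in> eisenstein_ints \<Longrightarrow> x * y \<in> eisenstein_ints"
proof -
  define w where "w = cis (2 * pi / 3)"
  have ev: "eisenstein_ints = range (\<lambda>p :: int poly. poly (map_poly of_int p) w)"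
    by (simp add: eisenstein_ints_def w_def)
  have hom: "poly (map_poly of_int (p + q)) w = poly (map_poly of_int p) w + poly (map_poly of_int q) w"
    "poly (map_poly of_int (p * q)) w = poly (map_poly of_int p) w * poly (map_poly of_int q) w"
    "poly (map_poly of_int (- p)) w = - poly (map_poly of_int p) w"
    for p q :: "int poly"
  proof -
    have add: "map_poly of_int (p + q) = map_poly of_int p + (map_poly of_int q :: complex poly)"
      for p q :: "int poly"
      by (intro poly_eqI) (simp add: coeff_map_poly)
    show "poly (map_poly of_int (p + q)) w = poly (map_poly of_int p) w + poly (map_poly of_int q) w"
      by (simp add: add)
    have "map_poly of_int (p * q) = map_poly of_int p * (map_poly of_int q :: complex poly)"
      by (intro poly_eqI) (simp add: coeff_map_poly coeff_mult)
    then show "poly (map_poly of_int (p * q)) w = poly (map_poly of_int p) w * poly (map_poly of_int q) w"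
      by simp
    have "map_poly of_int (- p) = - (map_poly of_int p :: complex poly)"
      by (intro poly_eqI) (simp add: coeff_map_poly)
    then show "poly (map_poly of_int (- p)) w = - poly (map_poly of_int p) w"
      by simp
  qed
  show "0 \<in> eisenstein_ints" unfolding ev by (rule range_eqI[of _ _ 0]) simp
  show "1 \<in> eisenstein_ints" unfolding ev by (rule range_eqI[of _ _ 1]) (simp add: map_poly_pCons)
  show "- x \<in> eisenstein_ints" if "x \<in> eisenstein_ints"
    using that unfolding ev by (auto simp flip: hom(3))
  show "x + y \<in> eisenstein_ints" if "x \<in> eisenstein_ints" "y \<in> eisenstein_ints"
    using that unfolding ev by (auto simp flip: hom(1))
  show "x * y \<in> eisenstein_ints" if "x \<in> eisenstein_ints" "y \<in> eisenstein_ints"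
    using that unfolding ev by (auto simp flip: hom(2))
qed

context
  fixes R :: "complex set"
  assumes R_closed:
    "0 \<in> R" "1 \<in> R" "\<And>x. x \<in> R \<Longrightarrow> - x \<in> R"
    "\<And>x y. x \<in> R \<Longrightarrow> y \<in> R \<Longrightarrow> x + y \<in> R" "\<And>x y. x \<in> R \<Longrightarrow> y \<in> R \<Longrightarrow> x * y \<in> R"
begin

lemma group_SL2: "group (SL2 R)"
proof (rule groupI)
  fix M assume M: "M \<in> carrier (SL2 R)"
  define N :: "complex^2^2" where
    "N = vector [vector [M$2$2, - (M$1$2)], vector [- (M$2$1), M$1$1]]"
  have N: "N$1$1 = M$2$2" "N$1$2 = - (M$1$2)" "N$2$1 = - (M$2$1)" "N$2$2 = M$1$1"
    by (simp_all add: N_def)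
  have "N \<in> carrier (SL2 R)"
    using M by (simp add: SL2_def forall_2 det_2 N R_closed mult.commute)
  moreover have "N ** M = mat 1"
    using M by (simp add: SL2_def det_2 vec_eq_iff forall_2 matrix_matrix_mult_def mat_def sum_2 N
        mult.commute)
  ultimately show "\<exists>N\<in>carrier (SL2 R). N \<otimes>\<^bsub>SL2 R\<^esub> M = \<one>\<^bsub>SL2 R\<^esub>"
    by (intro bexI[of _ N]) (simp_all add: SL2_def)
next
  show "M \<otimes>\<^bsub>SL2 R\<^esub> N \<in> carrier (SL2 R)"
    if "M \<in> carrier (SL2 R)" "N \<in> carrier (SL2 R)" for M N :: "complex^2^2"
    using that by (simp add: SL2_def det_mul) (simp add: matrix_matrix_mult_def sum_2 R_closed)
  show "\<one>\<^bsub>SL2 R\<^esub> \<in> carrier (SL2 R)"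
    by (simp add: SL2_def mat_def det_2 R_closed)
qed (simp_all add: SL2_def matrix_mul_assoc)

lemma normal_pm1: "{mat 1, - mat 1} \<lhd> SL2 R"
proof -
  interpret group "SL2 R" by (rule group_SL2)
  have neg: "- mat 1 ** M = - M" "M ** - mat 1 = - M" for M :: "complex^2^2"
    by (simp_all add: vec_eq_iff forall_2 matrix_matrix_mult_def mat_def sum_2)
  have incl: "{mat 1, - mat 1} \<subseteq> carrier (SL2 R)"
    by (simp add: SL2_def mat_def det_2 R_closed)
  have sub: "subgroup {mat 1, - mat 1} (SL2 R)"
  proof (rule subgroupI)
    show "{mat 1, - mat 1} \<subseteq> carrier (SL2 R)" by (rule incl)
    show "inv\<^bsub>SL2 R\<^esub> M \<in> {mat 1, - mat 1}" if M: "M \<in> {mat 1, - mat 1}" for M :: "complex^2^2"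
    proof -
      have "M \<otimes>\<^bsub>SL2 R\<^esub> M = \<one>\<^bsub>SL2 R\<^esub>" using M by (auto simp: SL2_def neg)
      moreover have "M \<in> carrier (SL2 R)" using M incl by blast
      ultimately have "inv\<^bsub>SL2 R\<^esub> M = M" by (intro inv_equality)
      with M show ?thesis by simp
    qed
    show "M \<otimes>\<^bsub>SL2 R\<^esub> N \<in> {mat 1, - mat 1}"
      if "M \<in> {mat 1, - mat 1}" "N \<in> {mat 1, - mat 1}" for M N :: "complex^2^2"
      using that by (auto simp: SL2_def neg)
  qed simp
  show ?thesis
  proof (rule normal_invI[OF sub])
    fix N M :: "complex^2^2"
    assume N: "N \<in> {mat 1, - mat 1}" and M: "M \<in> carrier (SL2 R)"
    have "M \<otimes>\<^bsub>SL2 R\<^esub> N = N \<otimes>\<^bsub>SL2 R\<^esub> M"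
      using N by (auto simp: SL2_def neg)
    moreover have "N \<in> carrier (SL2 R)" using N incl by blast
    ultimately have "M \<otimes>\<^bsub>SL2 R\<^esub> N \<otimes>\<^bsub>SL2 R\<^esub> inv\<^bsub>SL2 R\<^esub> M = N"
      using M by (simp add: m_assoc)
    with N show "M \<otimes>\<^bsub>SL2 R\<^esub> N \<otimes>\<^bsub>SL2 R\<^esub> inv\<^bsub>SL2 R\<^esub> M \<in> {mat 1, - mat 1}" by simp
  qed
qed

lemma group_PSL2: "group (PSL2 R)"
  unfolding PSL2_def by (rule normal.factorgroup_is_group[OF normal_pm1])

lemma carrier_PSL2: "carrier (PSL2 R) = (\<lambda>M. {M, - M}) ` carrier (SL2 R)"
proof -
  have [simp]: "- mat 1 ** M = - M" for M :: "complex^2^2"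
    by (simp add: vec_eq_iff forall_2 matrix_matrix_mult_def mat_def sum_2)
  show ?thesis
    by (auto simp: PSL2_def carrier_FactGroup r_coset_def SL2_def)
qed

end

text \<open>
  Since the classes in \<open>SL2 R\<close> are \<open>{M, - M}\<close>, the quotient \<open>PSL2 R\<close> is, as a set of classes with its
  multiplication, literally the subgroup of \<open>PSL2 UNIV\<close> of the classes with entries in \<open>R\<close>.
\<close>

lemma PSL2_eisenstein_subgroup:
  "subgroup (carrier (PSL2 eisenstein_ints)) (PSL2 UNIV)"
  "PSL2 eisenstein_ints = (PSL2 UNIV)\<lparr>carrier := (\<lambda>M. {M, - M}) ` carrier (SL2 eisenstein_ints)\<rparr>"
proof -
  interpret E: group "PSL2 eisenstein_ints"
    by (intro group_PSL2 eisenstein_ints_closed)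
  interpret C: group "PSL2 UNIV"
    by (intro group_PSL2) auto
  have carrierE: "carrier (PSL2 eisenstein_ints) = (\<lambda>M. {M, - M}) ` carrier (SL2 eisenstein_ints)"
    by (intro carrier_PSL2 eisenstein_ints_closed)
  have carrierC: "carrier (PSL2 UNIV) = (\<lambda>M. {M, - M}) ` carrier (SL2 UNIV)"
    by (intro carrier_PSL2) auto
  have mult: "monoid.mult (PSL2 eisenstein_ints) = monoid.mult (PSL2 UNIV)"
    by (auto simp: PSL2_def SL2_def set_mult_def fun_eq_iff)
  have one: "\<one>\<^bsub>PSL2 eisenstein_ints\<^esub> = \<one>\<^bsub>PSL2 UNIV\<^esub>"
    by (simp add: PSL2_def)
  show eq: "PSL2 eisenstein_ints
      = (PSL2 UNIV)\<lparr>carrier := (\<lambda>M. {M, - M}) ` carrier (SL2 eisenstein_ints)\<rparr>"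
    by (rule monoid.equality) (simp_all add: carrierE mult one)
  show "subgroup (carrier (PSL2 eisenstein_ints)) (PSL2 UNIV)"
  proof (rule C.group_incl_imp_subgroup)
    show "carrier (PSL2 eisenstein_ints) \<subseteq> carrier (PSL2 UNIV)"
      unfolding carrierE carrierC by (auto simp: SL2_def)
    show "group ((PSL2 UNIV)\<lparr>carrier := carrier (PSL2 eisenstein_ints)\<rparr>)"
      using E.is_group eq carrierE by simp
  qed
qed

end

theory Submission
  imports Defs
begin

text \<open>
  The Hermitian two by two matrices over the Eisenstein integers, with the quadratic form
  \<open>- 2 * det X\<close>, are a copy of the root lattice of \<open>A\<^sub>2\<^sup>+\<^sup>+\<close>; the simple roots become four explicit
  matrices \<open>root_mat i\<close> of determinant \<open>-1\<close>. In this model every reflection is antilinear: it is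
  \<open>X \<mapsto> M\<^sub>i X' M\<^sub>i\<^sup>*\<close>, where \<open>X'\<close> is the entrywise conjugate of \<open>X\<close> and the entries of \<open>M\<^sub>i\<close>
  (\<open>refl_mat i\<close>) are Eisenstein integers. A product of an even number of reflections is therefore
  \<open>X \<mapsto> M X M\<^sup>*\<close> with \<open>M\<close> an alternating product of the \<open>M\<^sub>i\<close> and their conjugates (\<open>word_mat\<close>).
  Such an \<open>M\<close> has determinant \<open>1\<close>, and the Coxeter relators evaluate to \<open>1\<close> or \<open>-1\<close>
  (\<open>word_mat_relator\<close>), so \<open>M\<close> up to sign depends only on the element of the Weyl group. This is the
  homomorphism from the even Weyl group to \<open>PSL\<^sub>2\<close>.

  It is injective because a word whose matrix is \<open>1\<close> or \<open>-1\<close> fixes all simple roots, and the Weyl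
  group acts faithfully on its roots. Faithfulness is Tits' theorem: if \<open>w s\<^sub>i\<close> is longer than \<open>w\<close>,
  then \<open>w\<close> sends the simple root of \<open>i\<close> to a positive root. For a simply laced diagram only braids
  of length two and three occur, and the induction over the length is short; it also suffices to
  measure positivity by one additive functional that is positive on the simple roots
  (\<open>ht_reduced_pos\<close>, \<open>faithful\<close>).

  It is surjective because the Eisenstein integers are norm-Euclidean: the inversion, the
  translations by Eisenstein integers and the diagonal matrices, all of which come from explicit words,
  generate \<open>SL\<^sub>2\<close> up to sign by the Euclidean algorithm on the first column
  (\<open>SL2_eisenstein_generated\<close>).
\<close>

section \<open>Reflection actions of simply laced Weyl groups\<close>

lemma weyl_prod_cong:
  "weyl_prod A u = weyl_prod A v \<Longrightarrow> weyl_prod A (x @ u @ y) = weyl_prod A (x @ v @ y)"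
  by (simp only: weyl_prod_append[symmetric])

lemma weyl_prod_relator:
  assumes "i \<noteq> j" "coxeter_exponent A i j = enat n"
  shows "weyl_prod A (concat (replicate n [i, j])) = weyl_prod A []"
  unfolding weyl_prod_eq word_class_eq_iff map_concat map_replicate
  using assms by (auto intro!: word_eq.relator simp: weyl_relators_def)

lemma weyl_prod_square: "weyl_prod A [i, i] = weyl_prod A []"
  using weyl_prod_rev[of A "[i]"] by simp

definition reduced :: "('i \<Rightarrow> 'i \<Rightarrow> int) \<Rightarrow> 'i list \<Rightarrow> bool" where
  "reduced A u \<longleftrightarrow> (\<forall>v. weyl_prod A v = weyl_prod A u \<longrightarrow> length u \<le> length v)"

lemma reduced_representative:
  obtains v where "weyl_prod A v = weyl_prod A u" "reduced A v"
proof -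
  obtain v where "weyl_prod A v = weyl_prod A u"
    and "\<And>v'. weyl_prod A v' = weyl_prod A u \<Longrightarrow> length v \<le> length v'"
    using ex_has_least_nat[of "\<lambda>v. weyl_prod A v = weyl_prod A u" u length] by blast
  then show thesis by (intro that[of v]) (auto simp: reduced_def)
qed

lemma reduced_prefix:
  assumes "reduced A (u @ x)" shows "reduced A u"
  unfolding reduced_def
proof (intro allI impI)
  fix v assume "weyl_prod A v = weyl_prod A u"
  from weyl_prod_cong[OF this, of "[]" x] have "weyl_prod A (v @ x) = weyl_prod A (u @ x)"
    by simp
  with assms have "length (u @ x) \<le> length (v @ x)"
    unfolding reduced_def by blast
  then show "length u \<le> length v" by simp
qed

lemma reduced_transfer:
  "reduced A u \<Longrightarrow> weyl_prod A u = weyl_prod A v \<Longrightarrow> length u = length v \<Longrightarrow> reduced A v"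
  by (auto simp: reduced_def)

text \<open>
  An action of the Weyl group by additive maps, presented by what the generators do to the images of
  the simple roots. The functional \<open>ht\<close> stands in for the cone of positive roots: the only properties
  of the cone that the length argument uses are that it contains the simple roots, is closed under
  addition and does not contain the negative of any of its elements.
\<close>

locale simply_laced_reflections =
  fixes A :: "'i \<Rightarrow> 'i \<Rightarrow> int"
    and root :: "'i \<Rightarrow> 'v :: ab_group_add"
    and s :: "'i \<Rightarrow> 'v \<Rightarrow> 'v"
    and ht :: "'v \<Rightarrow> real"
  assumes simply_laced:
      "i \<noteq> j \<Longrightarrow> A i j = 0 \<and> A j i = 0 \<or> A i j = -1 \<and> A j i = -1"
    and s_add: "s i (x + y) = s i x + s i y"
    and s_self: "s i (root i) = - root i"
    and s_orthogonal: "i \<noteq> j \<Longrightarrow> A i j = 0 \<Longrightarrow> s i (root j) = root j"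
    and s_adjacent: "i \<noteq> j \<Longrightarrow> A i j = -1 \<Longrightarrow> s i (root j) = root j + root i"
    and action: "weyl_prod A u = weyl_prod A v \<Longrightarrow> foldr s u = foldr s v"
    and ht_add: "ht (x + y) = ht x + ht y"
    and ht_root: "ht (root i) > 0"
begin

lemma foldr_add: "foldr s u (x + y) = foldr s u x + foldr s u y"
  by (induction u) (simp_all add: s_add)

lemma foldr_minus: "foldr s u (- x) = - foldr s u x"
proof -
  have "foldr s u 0 + foldr s u 0 = foldr s u 0 + 0"
    by (simp flip: foldr_add)
  then have "foldr s u 0 = 0" by (simp only: add_left_cancel)
  then have "foldr s u x + foldr s u (- x) = 0"
    by (simp flip: foldr_add)
  then show ?thesis by (simp add: eq_neg_iff_add_eq_0 add.commute)
qed

lemma ht_minus: "ht (- x) = - ht x"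
proof -
  have "ht 0 = 0" using ht_add[of 0 0] by simp
  then show ?thesis using ht_add[of x "- x"] by simp
qed

lemma commute:
  assumes "i \<noteq> j" "A i j = 0"
  shows "weyl_prod A [i, j] = weyl_prod A [j, i]"
proof -
  have "coxeter_exponent A i j = enat 2"
    using assms by (simp add: coxeter_exponent_def numeral_eq_enat)
  from weyl_prod_relator[OF assms(1) this]
  have "weyl_prod A [i, j, i, j] = weyl_prod A []" by (simp add: numeral_eq_Suc)
  from weyl_prod_cong[OF this, of "[]" "[j, i]"]
  have "weyl_prod A ([i, j] @ [i, j, j, i]) = weyl_prod A [j, i]" by simp
  moreover have "weyl_prod A [i, j, j, i] = weyl_prod A []"
    using weyl_prod_rev[of A "[j, i]"] by simp
  ultimately show ?thesis
    using weyl_prod_cong[of A "[i, j, j, i]" "[]" "[i, j]" "[]"] by simp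
qed

lemma braid:
  assumes "i \<noteq> j" "A i j = -1"
  shows "weyl_prod A [i, j, i] = weyl_prod A [j, i, j]"
proof -
  have "coxeter_exponent A i j = enat 3"
    using assms simply_laced[OF assms(1)] by (auto simp: coxeter_exponent_def numeral_eq_enat)
  from weyl_prod_relator[OF assms(1) this]
  have "weyl_prod A [i, j, i, j, i, j] = weyl_prod A []" by (simp add: numeral_eq_Suc)
  from weyl_prod_cong[OF this, of "[]" "[j, i, j]"]
  have "weyl_prod A ([i, j, i] @ [j, i, j, j, i, j]) = weyl_prod A [j, i, j]" by simp
  moreover have "weyl_prod A [j, i, j, j, i, j] = weyl_prod A []"
    using weyl_prod_rev[of A "[j, i, j]"] by simp
  ultimately show ?thesis
    using weyl_prod_cong[of A "[j, i, j, j, i, j]" "[]" "[i, j, i]" "[]"] by simp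
qed

text \<open>
  Tits' positivity, by induction on the length of \<open>u\<close>. Let \<open>u\<close> end in \<open>j\<close>, say \<open>u = w j\<close>. If \<open>i\<close> and
  \<open>j\<close> commute, then \<open>s j\<close> fixes \<open>root i\<close> and \<open>w i\<close> is again reduced. If they are adjacent, the root
  in question is the sum of the images of \<open>root i\<close> and \<open>root j\<close> under \<open>w\<close>. The second is positive since
  \<open>w j\<close> is reduced. The first is positive if \<open>w i\<close> is reduced. Otherwise \<open>w\<close> can be rewritten
  to end in \<open>i\<close>, say \<open>w = v i\<close>; then the sum is the image of \<open>root j\<close> under \<open>v\<close>, and the braid
  relation turns \<open>v i j i\<close> into \<open>v j i j\<close>, which shows that \<open>v j\<close> is reduced.
\<close>

lemma ht_reduced_pos:
  "reduced A (u @ [i]) \<Longrightarrow> ht (foldr s u (root i)) > 0"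
proof (induction "length u" arbitrary: u i rule: less_induct)
  case less
  show ?case
  proof (cases u rule: rev_cases)
    case Nil
    then show ?thesis by (simp add: ht_root)
  next
    case (snoc w j)
    have red: "reduced A (w @ [j, i])" using less.prems snoc by simp
    then have red_j: "reduced A (w @ [j])" using reduced_prefix[of A "w @ [j]" "[i]"] by simp
    have IH: "reduced A (v @ [k]) \<Longrightarrow> ht (foldr s v (root k)) > 0"
      if "length v \<le> length w" for v k
      using less.hyps[of v k] that snoc by simp
    have "j \<noteq> i"
    proof
      assume "j = i"
      then have "weyl_prod A w = weyl_prod A (w @ [j, i])"
        using weyl_prod_cong[OF weyl_prod_square[of A i], of w "[]"] by simp
      with red show False by (auto simp: reduced_def)
    qed
    show ?thesis
    proof (cases "A j i = 0")
      case True
      have "weyl_prod A (w @ [j, i]) = weyl_prod A (w @ [i, j])"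
        using weyl_prod_cong[OF commute[OF \<open>j \<noteq> i\<close> True], of w "[]"] by simp
      then have "reduced A (w @ [i])"
        using reduced_transfer[OF red] reduced_prefix[of A "w @ [i]" "[j]"] by simp
      then have "ht (foldr s w (root i)) > 0" by (intro IH) auto
      then show ?thesis using snoc s_orthogonal[OF \<open>j \<noteq> i\<close> True] by simp
    next
      case False
      then have A: "A j i = -1" "A i j = -1" using simply_laced[OF \<open>j \<noteq> i\<close>] by auto
      have val: "foldr s u (root i) = foldr s w (root i + root j)"
        using snoc s_adjacent[OF \<open>j \<noteq> i\<close> A(1)] by simp
      show ?thesis
      proof (cases "reduced A (w @ [i])")
        case True
        then show ?thesis
          using IH[of w i] IH[of w j] red_j by (simp add: val foldr_add ht_add)
      next
        case False
        \<comment> \<open>Lengths change by exactly one along a generator, because parity is well defined on the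
          group; hence \<open>v\<close> is one letter shorter than \<open>w\<close>.\<close>
        obtain v where v: "weyl_prod A v = weyl_prod A (w @ [i])" "reduced A v"
          by (rule reduced_representative)
        have "length v \<noteq> length (w @ [i])"
          using False v by (auto intro: reduced_transfer)
        moreover have "length v \<le> length (w @ [i])"
          using v unfolding reduced_def by metis
        moreover have "even (length v) \<longleftrightarrow> even (length (w @ [i]))"
          using v(1) by (rule weyl_prod_parity)
        moreover have w: "weyl_prod A w = weyl_prod A (v @ [i])"
          using weyl_prod_cong[OF v(1), of "[]" "[i]"]
            weyl_prod_cong[OF weyl_prod_square[of A i], of w "[]"] by simp
        moreover have "length w \<le> length (v @ [i])"
          using reduced_prefix[OF red_j] w unfolding reduced_def by metis
        ultimately have len: "length w = Suc (length v)"
          by simp presburger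
        have "weyl_prod A (w @ [j, i]) = weyl_prod A (v @ [i, j, i])"
          using weyl_prod_cong[OF w, of "[]" "[j, i]"] by simp
        also have "\<dots> = weyl_prod A (v @ [j, i, j])"
          using weyl_prod_cong[OF braid[OF \<open>j \<noteq> i\<close>[symmetric] A(2)], of v "[]"] by simp
        finally have "reduced A (v @ [j])"
          using reduced_transfer[OF red] reduced_prefix[of A "v @ [j]" "[i, j]"] len by simp
        then have "ht (foldr s v (root j)) > 0" by (intro IH) (use len in auto)
        moreover have "foldr s w = foldr s (v @ [i])" using w by (rule action)
        ultimately show ?thesis
          using s_adjacent[OF \<open>j \<noteq> i\<close>[symmetric] A(2)] by (simp add: val s_add s_self)
      qed
    qed
  qed
qed

text \<open>
  A nonempty reduced word ending in \<open>i\<close> cannot fix \<open>root i\<close>: its last letter negates \<open>root i\<close>, and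
  the rest of the word keeps the height of the result negative.
\<close>

theorem faithful:
  assumes "\<And>i. foldr s u (root i) = root i"
  shows "weyl_prod A u = weyl_prod A []"
proof -
  obtain v where v: "weyl_prod A v = weyl_prod A u" "reduced A v"
    by (rule reduced_representative)
  show ?thesis
  proof (cases v rule: rev_cases)
    case Nil
    with v show ?thesis by simp
  next
    case (snoc w i)
    have "root i = foldr s v (root i)" using assms action[OF v(1)] by simp
    then have "root i = - foldr s w (root i)" using snoc by (simp add: s_self foldr_minus)
    then have "ht (root i) = - ht (foldr s w (root i))" by (metis ht_minus)
    with ht_reduced_pos[of w i] ht_root[of i] v(2) snoc show ?thesis by simp
  qed
qed

end

section \<open>Two by two complex matrices\<close>

definition mat2 :: "'a \<Rightarrow> 'a \<Rightarrow> 'a \<Rightarrow> 'a \<Rightarrow> 'a::zero^2^2" where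
  "mat2 a b c d = vector [vector [a, b], vector [c, d]]"

lemma mat2_nth [simp]:
  "mat2 a b c d $ 1 $ 1 = a" "mat2 a b c d $ 1 $ 2 = b"
  "mat2 a b c d $ 2 $ 1 = c" "mat2 a b c d $ 2 $ 2 = d"
  by (simp_all add: mat2_def)

lemma mat2_eq_iff [simp]:
  "mat2 a b c d = mat2 a' b' c' d' \<longleftrightarrow> a = a' \<and> b = b' \<and> c = c' \<and> d = d'"
  by (auto simp: vec_eq_iff forall_2)

lemma mat2_cases: obtains a b c d where "M = mat2 a b c d"
  by (rule that[of "M$1$1" "M$1$2" "M$2$1" "M$2$2"]) (simp add: vec_eq_iff forall_2)

lemma mat2_mult [simp]:
  fixes a :: "'a::semiring_1"
  shows "mat2 a b c d ** mat2 a' b' c' d' =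
    mat2 (a * a' + b * c') (a * b' + b * d') (c * a' + d * c') (c * b' + d * d')"
  by (simp add: vec_eq_iff forall_2 matrix_matrix_mult_def sum_2)

lemma mat2_add [simp]:
  fixes a :: "'a::monoid_add"
  shows "mat2 a b c d + mat2 a' b' c' d' = mat2 (a + a') (b + b') (c + c') (d + d')"
  by (simp add: vec_eq_iff forall_2)

lemma mat2_minus [simp]:
  fixes a :: "'a::group_add"
  shows "- mat2 a b c d = mat2 (- a) (- b) (- c) (- d)"
  by (simp add: vec_eq_iff forall_2)

lemma mat_1_eq_mat2: "mat 1 = mat2 1 0 0 1"
  by (simp add: vec_eq_iff forall_2 mat_def)

lemma transpose_mat2 [simp]: "transpose (mat2 a b c d) = mat2 a c b d"
  by (simp add: vec_eq_iff forall_2 transpose_def)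

lemma det_mat2 [simp]: "det (mat2 a b c d) = a * d - b * c"
  by (simp add: det_2)

definition conj_mat :: "complex^2^2 \<Rightarrow> complex^2^2" where
  "conj_mat M = (\<chi> i j. cnj (M $ i $ j))"

lemma conj_mat2 [simp]:
  "conj_mat (mat2 a b c d) = mat2 (cnj a) (cnj b) (cnj c) (cnj d)"
  by (simp add: vec_eq_iff forall_2 conj_mat_def)

lemma conj_mat_simps [simp]:
  "conj_mat (conj_mat M) = M"
  "conj_mat (mat 1) = mat 1"
  "conj_mat (- M) = - conj_mat M"
  "conj_mat (M ** N) = conj_mat M ** conj_mat N"
  "conj_mat (transpose M) = transpose (conj_mat M)"
  "det (conj_mat M) = cnj (det M)"
  by (cases M rule: mat2_cases; cases N rule: mat2_cases; simp add: mat_1_eq_mat2)+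

lemma mat2_mult_minus [simp]:
  fixes M N :: "complex^2^2"
  shows "(- M) ** N = - (M ** N)" "M ** (- N) = - (M ** N)"
  by (cases M rule: mat2_cases; cases N rule: mat2_cases; simp)+

lemma transpose_minus [simp]:
  fixes M :: "complex^2^2"
  shows "transpose (- M) = - transpose M"
  by (cases M rule: mat2_cases; simp)

section \<open>The reflections of \<open>A\<^sub>2\<^sup>+\<^sup>+\<close> on Hermitian matrices\<close>

definition omega :: complex where
  "omega = cis (2 * pi / 3)"

lemma Re_omega [simp]: "Re omega = - 1 / 2"
  and Im_omega [simp]: "Im omega = sqrt 3 / 2"
  by (simp_all add: omega_def cos_120 sin_120)

lemma cnj_omega [simp]: "cnj omega = - 1 - omega"
  by (simp add: complex_eq_iff)

lemma omega_square [simp]: "omega * omega = - 1 - omega"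
  by (simp add: complex_eq_iff)

lemma omega_square_left [simp]: "omega * (omega * x) = - x - omega * x"
  by (simp add: algebra_simps flip: mult.assoc)

text \<open>
  A Hermitian matrix with rows \<open>(a, x)\<close> and \<open>(cnj x, d)\<close> has \<open>- 2 * det = 2 * x * cnj x - 2 * a * d\<close>,
  the sum of the \<open>A\<^sub>2\<close> lattice of Eisenstein integers \<open>x\<close> and a hyperbolic plane. The roots \<open>1\<close> and
  \<open>omega\<close> of \<open>A\<^sub>2\<close> are simple with highest root \<open>1 + omega\<close>, and the nodes \<open>0\<close> and \<open>-1\<close> extend them
  through the plane in the usual way. Everywhere \<open>omega\<^sup>2\<close> is written as \<open>- 1 - omega\<close>, which makes
  normal forms unique.
\<close>

fun root_mat :: "A2pp_node \<Rightarrow> complex^2^2" where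
  "root_mat Nm1 = mat2 1 0 0 (-1)"
| "root_mat N0 = mat2 (-1) (- 1 - omega) omega 0"
| "root_mat N1 = mat2 0 1 1 0"
| "root_mat N2 = mat2 0 omega (- 1 - omega) 0"

text \<open>
  Let \<open>J\<close> be the matrix with rows \<open>(0, 1)\<close> and \<open>(-1, 0)\<close>. The reflection in a root \<open>a\<close> with
  \<open>det a = -1\<close> is \<open>X \<mapsto> a adj(X) a\<close>, and the adjugate of a Hermitian \<open>X\<close> is \<open>J X' J\<^sup>*\<close> with
  \<open>X'\<close> the entrywise conjugate. Since \<open>a\<close> is Hermitian, the reflection is \<open>X \<mapsto> (a J) X' (a J)\<^sup>*\<close>.
\<close>

definition refl_mat :: "A2pp_node \<Rightarrow> complex^2^2" where
  "refl_mat i = root_mat i ** mat2 0 1 (-1) 0"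

lemma refl_mat_simps [simp]:
  "refl_mat Nm1 = mat2 0 1 1 0"
  "refl_mat N0 = mat2 (1 + omega) (-1) 0 omega"
  "refl_mat N1 = mat2 (-1) 0 0 1"
  "refl_mat N2 = mat2 (- omega) 0 0 (- 1 - omega)"
  by (simp_all add: refl_mat_def)

text \<open>
  The conjugation records that each reflection is antilinear: moving the conjugation of one letter
  past the matrices to its right conjugates them.
\<close>

fun word_mat :: "A2pp_node list \<Rightarrow> complex^2^2" where
  "word_mat [] = mat 1"
| "word_mat (i # u) = refl_mat i ** conj_mat (word_mat u)"

lemma word_mat_append:
  "word_mat (u @ v) =
     word_mat u ** (if even (length u) then word_mat v else conj_mat (word_mat v))"
  by (induction u) (simp_all add: matrix_mul_assoc)

definition refl :: "A2pp_node \<Rightarrow> complex^2^2 \<Rightarrow> complex^2^2" where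
  "refl i X = refl_mat i ** conj_mat X ** transpose (conj_mat (refl_mat i))"

lemma foldr_refl:
  "foldr refl u X =
     word_mat u ** (if even (length u) then X else conj_mat X) ** transpose (conj_mat (word_mat u))"
  by (induction u) (simp_all add: refl_def matrix_mul_assoc matrix_transpose_mul)

lemma word_mat_square: "word_mat [i, i] = mat 1"
  by (cases i) (simp_all add: mat_1_eq_mat2 algebra_simps)

text \<open>
  The signs cannot be avoided: already \<open>N1\<close> and \<open>Nm1\<close>, which commute in the Weyl group, give the
  inversion, whose square is \<open>-1\<close>. This is why the target is \<open>PSL\<^sub>2\<close> and not \<open>SL\<^sub>2\<close>.
\<close>

lemma word_mat_relator:
  assumes "i \<noteq> j" "coxeter_exponent A2pp_cartan i j = enat n"
  shows "word_mat (concat (replicate n [i, j])) \<in> {mat 1, - mat 1}"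
proof -
  have "n = (if {i, j} \<in> A2pp_edges then 3 else 2)"
    using assms coxeter_exponent_A2pp[OF assms(1)]
    by (simp add: numeral_eq_enat split: if_splits)
  then show ?thesis
    using assms(1)
    by (cases i; cases j)
       (auto simp: A2pp_edges_def doubleton_eq_iff mat_1_eq_mat2 numeral_eq_Suc algebra_simps)
qed

lemma word_mat_word_eq:
  assumes "word_eq (weyl_relators A2pp_cartan) u v"
  shows "word_mat (map fst u) \<in> {word_mat (map fst v), - word_mat (map fst v)}"
  using assms
proof (induction rule: word_eq.induct)
  case (append u u' v v')
  have "even (length u) \<longleftrightarrow> even (length u')"
    using append.hyps(1) by (rule word_eq_parity)
  with append.IH show ?case by (auto simp: word_mat_append)
next
  case (cancel a b)
  show ?case using word_mat_square[of a] by simp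
next
  case (relator r)
  then consider i where "r = [(i, True), (i, True)]"
    | i j n where "i \<noteq> j" "coxeter_exponent A2pp_cartan i j = enat n"
        "r = concat (replicate n [(i, True), (j, True)])"
    by (auto simp: weyl_relators_def)
  then show ?case
  proof cases
    case 1
    then show ?thesis using word_mat_square[of i] by simp
  next
    case 2
    then show ?thesis using word_mat_relator[of i j n] by (simp add: map_concat)
  qed
qed auto

lemma word_mat_weyl_prod:
  assumes "weyl_prod A2pp_cartan u = weyl_prod A2pp_cartan v"
  shows "word_mat u \<in> {word_mat v, - word_mat v}"
  using assms word_mat_word_eq[of "map (\<lambda>i. (i, True)) u" "map (\<lambda>i. (i, True)) v"]
  by (simp add: weyl_prod_eq word_class_eq_iff comp_def)

text \<open>
  The coefficients are chosen so that all four simple roots have height \<open>1\<close>; on the root lattice this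
  is the sum of the coordinates with respect to the simple roots.
\<close>

definition height :: "complex^2^2 \<Rightarrow> real" where
  "height X = - 3 * Re (X $ 1 $ 1) - 4 * Re (X $ 2 $ 2) - 2 * Re (omega * X $ 1 $ 2)"

interpretation A2pp: simply_laced_reflections A2pp_cartan root_mat refl height
proof
  fix i j :: A2pp_node and X Y :: "complex^2^2" and u v :: "A2pp_node list"
  show "A2pp_cartan i j = 0 \<and> A2pp_cartan j i = 0 \<or> A2pp_cartan i j = -1 \<and> A2pp_cartan j i = -1"
    if "i \<noteq> j"
    using that by (auto simp: A2pp_cartan_def insert_commute)
  show "refl i (X + Y) = refl i X + refl i Y"
    by (cases X rule: mat2_cases; cases Y rule: mat2_cases; cases "refl_mat i" rule: mat2_cases)
       (simp add: refl_def algebra_simps)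
  show "refl i (root_mat i) = - root_mat i"
    by (cases i) (simp_all add: refl_def algebra_simps)
  show "refl i (root_mat j) = root_mat j" if "i \<noteq> j" "A2pp_cartan i j = 0"
    using that by (cases i; cases j)
      (simp_all add: refl_def algebra_simps A2pp_cartan_def A2pp_edges_def doubleton_eq_iff)
  show "refl i (root_mat j) = root_mat j + root_mat i" if "i \<noteq> j" "A2pp_cartan i j = -1"
    using that by (cases i; cases j)
      (simp_all add: refl_def algebra_simps A2pp_cartan_def A2pp_edges_def doubleton_eq_iff)
  show "foldr refl u = foldr refl v" if "weyl_prod A2pp_cartan u = weyl_prod A2pp_cartan v"
    using word_mat_weyl_prod[OF that] weyl_prod_parity[OF that]
    by (auto simp: fun_eq_iff foldr_refl)
  show "height (X + Y) = height X + height Y"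
    by (simp add: height_def algebra_simps)
  show "height (root_mat i) > 0"
    by (cases i) (simp_all add: height_def algebra_simps)
qed

text \<open>
  The matrices \<open>1\<close> and \<open>-1\<close> both act on Hermitian matrices as the identity, so faithfulness applies.
\<close>

theorem word_mat_kernel:
  assumes "even (length u)" "word_mat u \<in> {mat 1, - mat 1}"
  shows "weyl_prod A2pp_cartan u = weyl_prod A2pp_cartan []"
proof (rule A2pp.faithful)
  show "foldr refl u (root_mat i) = root_mat i" for i
    using assms by (auto simp: foldr_refl transpose_mat)
qed

section \<open>Generation of \<open>SL\<^sub>2\<close> over the Eisenstein integers\<close>

lemma eisensteinE:
  assumes "x \<in> eisenstein_ints"
  obtains a b where "x = of_int a + of_int b * omega"
  using assms by (auto simp: eisenstein_ints_eq omega_def)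

lemma eisensteinI: "of_int a + of_int b * omega \<in> eisenstein_ints"
  by (auto simp: eisenstein_ints_eq omega_def)

lemma of_int_in_eisenstein [simp]: "of_int a \<in> eisenstein_ints"
  using eisensteinI[of a 0] by simp

lemma omega_in_eisenstein [simp]: "omega \<in> eisenstein_ints"
  using eisensteinI[of 0 1] by simp

lemma cmod_omega_combination:
  "(cmod (of_real x + of_real y * omega))\<^sup>2 = x\<^sup>2 - x * y + y\<^sup>2"
  unfolding cmod_power2 by (simp add: power2_eq_square algebra_simps)

lemma cmod_eisenstein:
  "(cmod (of_int a + of_int b * omega))\<^sup>2 = of_int (a\<^sup>2 - a * b + b\<^sup>2)"
  using cmod_omega_combination[of "of_int a" "of_int b"] by simp

lemma eisenstein_norm_nat:
  assumes "x \<in> eisenstein_ints"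
  obtains n :: nat where "(cmod x)\<^sup>2 = of_nat n"
proof -
  obtain a b where x: "x = of_int a + of_int b * omega"
    using assms by (rule eisensteinE)
  have "(0::real) \<le> of_int (a\<^sup>2 - a * b + b\<^sup>2)"
    unfolding cmod_eisenstein[symmetric] by simp
  then have "0 \<le> a\<^sup>2 - a * b + b\<^sup>2" by (simp only: of_int_0_le_iff)
  then show thesis
    by (intro that[of "nat (a\<^sup>2 - a * b + b\<^sup>2)"]) (simp add: x cmod_eisenstein)
qed

text \<open>
  Rounding both coordinates of \<open>z\<close> with respect to \<open>1\<close> and \<open>omega\<close> leaves an error
  \<open>u + v * omega\<close> with \<open>u\<close> and \<open>v\<close> at most \<open>1 / 2\<close> in absolute value, whose squared norm
  \<open>u\<^sup>2 - u * v + v\<^sup>2\<close> is at most \<open>3 / 4\<close>.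
\<close>

lemma eisenstein_approximation:
  obtains q where "q \<in> eisenstein_ints" "cmod (z - q) < 1"
proof -
  define y where "y = Im z * 2 / sqrt 3"
  define x where "x = Re z + y / 2"
  have z: "z = of_real x + of_real y * omega"
    by (simp add: complex_eq_iff x_def y_def)
  define u v where "u = x - of_int (round x)" and "v = y - of_int (round y)"
  have uv: "\<bar>u\<bar> \<le> 1 / 2" "\<bar>v\<bar> \<le> 1 / 2"
    using of_int_round_abs_le[of x] of_int_round_abs_le[of y]
    by (simp_all add: u_def v_def abs_minus_commute)
  define q where "q = of_int (round x) + of_int (round y) * omega"
  have "z - q = of_real u + of_real v * omega"
    by (simp add: z q_def u_def v_def algebra_simps)
  then have "(cmod (z - q))\<^sup>2 = u\<^sup>2 - u * v + v\<^sup>2"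
    by (simp only: cmod_omega_combination)
  also have "\<dots> \<le> 3 / 4"
  proof -
    have "u\<^sup>2 \<le> 1 / 4" "v\<^sup>2 \<le> 1 / 4"
      using uv[THEN power_mono, of 2] by (simp_all add: power_divide)
    moreover have "\<bar>u\<bar> * \<bar>v\<bar> \<le> 1 / 2 * (1 / 2)"
      using uv by (intro mult_mono) auto
    then have "- (u * v) \<le> 1 / 4" by (simp flip: abs_mult)
    ultimately show ?thesis by simp
  qed
  finally have "(cmod (z - q))\<^sup>2 < 1\<^sup>2" by simp
  then have "cmod (z - q) < 1" by (rule power2_less_imp_less) simp
  moreover have "q \<in> eisenstein_ints"
    unfolding q_def by (intro eisenstein_ints_closed) simp_all
  ultimately show thesis by (rule that[rotated])
qed

text \<open>
  Units have norm \<open>1\<close>, and \<open>4 * (a\<^sup>2 - a * b + b\<^sup>2) = (2 * a - b)\<^sup>2 + 3 * b\<^sup>2\<close> (and its mirror image) leaves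
  only coordinates in \<open>{-1, 0, 1}\<close>.
\<close>

lemma eisenstein_units:
  assumes "x \<in> eisenstein_ints" "y \<in> eisenstein_ints" "x * y = 1"
  shows "(x, y) \<in> {(1, 1), (omega, - 1 - omega), (- 1 - omega, omega),
    (-1, -1), (- omega, 1 + omega), (1 + omega, - omega)}"
proof -
  obtain m n :: nat where mn: "(cmod x)\<^sup>2 = of_nat m" "(cmod y)\<^sup>2 = of_nat n"
    using assms eisenstein_norm_nat by metis
  have "of_nat m * of_nat n = (1::real)"
    unfolding mn[symmetric]
    using assms(3) by (simp flip: power_mult_distrib norm_mult)
  then have "m * n = 1" by (metis of_nat_1 of_nat_eq_iff of_nat_mult)
  then have "m = 1" by simp
  obtain a b where x: "x = of_int a + of_int b * omega"
    using assms(1) by (rule eisensteinE)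
  have "of_int (a\<^sup>2 - a * b + b\<^sup>2) = (1::real)"
    using mn(1) \<open>m = 1\<close> by (simp only: x cmod_eisenstein of_nat_1)
  then have ab: "a\<^sup>2 - a * b + b\<^sup>2 = 1" by linarith
  have "(2 * a - b)\<^sup>2 + 3 * b\<^sup>2 = 4" "(2 * b - a)\<^sup>2 + 3 * a\<^sup>2 = 4"
    using ab by (simp_all add: power2_eq_square algebra_simps)
  then have "3 * b\<^sup>2 \<le> 4" "3 * a\<^sup>2 \<le> 4" by (smt (verit) zero_le_power2)+
  then have "\<bar>b\<bar>\<^sup>2 < 2\<^sup>2" "\<bar>a\<bar>\<^sup>2 < 2\<^sup>2" by simp_all
  then have "\<bar>b\<bar> < 2" "\<bar>a\<bar> < 2" by (auto intro: power2_less_imp_less)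
  then have "a \<in> {-1, 0, 1}" "b \<in> {-1, 0, 1}" by auto
  with ab have "(a, b) \<in> {(1, 0), (-1, 0), (0, 1), (0, -1), (1, 1), (-1, -1)}"
    by auto
  moreover have "y = cnj x"
  proof -
    have "x * cnj x = 1" using mn(1) \<open>m = 1\<close> by (simp flip: complex_norm_square)
    moreover have "x \<noteq> 0" using assms(3) by auto
    ultimately show ?thesis using assms(3) by (metis mult_left_cancel)
  qed
  ultimately show ?thesis by (elim insertE emptyE) (simp_all add: x)
qed

definition even_word_mats :: "(complex^2^2) set" where
  "even_word_mats = {M. \<exists>u. even (length u) \<and> M \<in> {word_mat u, - word_mat u}}"

lemma even_word_matsI: "even (length u) \<Longrightarrow> M \<in> {word_mat u, - word_mat u} \<Longrightarrow> M \<in> even_word_mats"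
  by (auto simp: even_word_mats_def)

lemma even_word_mats_mult:
  assumes "M \<in> even_word_mats" "N \<in> even_word_mats"
  shows "M ** N \<in> even_word_mats"
proof -
  obtain u v where "even (length u)" "M \<in> {word_mat u, - word_mat u}"
    "even (length v)" "N \<in> {word_mat v, - word_mat v}"
    using assms by (auto simp: even_word_mats_def)
  then show ?thesis
    by (intro even_word_matsI[of "u @ v"]) (auto simp: word_mat_append)
qed

lemma even_word_mats_minus: "M \<in> even_word_mats \<Longrightarrow> - M \<in> even_word_mats"
  by (auto simp: even_word_mats_def)

lemma inversion_in_even_word_mats: "mat2 0 (-1) 1 0 \<in> even_word_mats"
  by (rule even_word_matsI[of "[N1, Nm1]"]) (simp_all add: mat_1_eq_mat2)

lemma diagonal_in_even_word_mats:
  assumes "x \<in> eisenstein_ints" "y \<in> eisenstein_ints" "x * y = 1"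
  shows "mat2 x 0 0 y \<in> even_word_mats"
proof -
  have 1: "mat2 1 0 0 1 \<in> even_word_mats"
    by (rule even_word_matsI[of "[]"]) (simp_all add: mat_1_eq_mat2)
  have 2: "mat2 omega 0 0 (- 1 - omega) \<in> even_word_mats"
    by (rule even_word_matsI[of "[N2, N1]"]) (simp_all add: mat_1_eq_mat2)
  have 3: "mat2 (- 1 - omega) 0 0 omega \<in> even_word_mats"
    by (rule even_word_matsI[of "[N1, N2]"]) (simp_all add: mat_1_eq_mat2)
  show ?thesis
    using eisenstein_units[OF assms] 1 2 3 1[THEN even_word_mats_minus]
      2[THEN even_word_mats_minus] 3[THEN even_word_mats_minus]
    by (auto simp: add.commute)
qed

text \<open>
  The words in the finite and affine nodes form the affine Weyl group of \<open>A\<^sub>2\<close>, whose translations are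
  the lattice of Eisenstein integers. One explicit translation, by \<open>omega\<close>, is enough: conjugation
  with the diagonal matrix of \<open>omega\<close> rotates it through \<open>1\<close>, \<open>omega\<close> and \<open>omega\<^sup>2\<close>, and the sum of
  two of these is the negative of the third.
\<close>

lemma translation_in_even_word_mats:
  assumes "x \<in> eisenstein_ints"
  shows "mat2 1 x 0 1 \<in> even_word_mats"
proof -
  define L where "L = {x. mat2 1 x 0 1 \<in> even_word_mats}"
  have add: "x + y \<in> L" if "x \<in> L" "y \<in> L" for x y
    using even_word_mats_mult[of "mat2 1 y 0 1" "mat2 1 x 0 1"] that by (simp add: L_def)
  have zero: "0 \<in> L"
    using diagonal_in_even_word_mats[of 1 1] by (simp add: L_def eisenstein_ints_closed)
  have omega: "omega \<in> L"
    unfolding L_def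
    by (intro CollectI even_word_matsI[of "[N1, N0, N1, N2]"])
       (simp_all add: mat_1_eq_mat2 algebra_simps)
  have rotate: "(- 1 - omega) * x \<in> L" if "x \<in> L" for x
  proof -
    have omega2: "- 1 - omega \<in> eisenstein_ints" using eisensteinI[of "-1" "-1"] by simp
    have inv: "omega * (- 1 - omega) = 1" by (simp add: right_diff_distrib)
    have "mat2 omega 0 0 (- 1 - omega) ** mat2 1 x 0 1 ** mat2 (- 1 - omega) 0 0 omega
        \<in> even_word_mats"
      using that omega2 inv
      by (intro even_word_mats_mult diagonal_in_even_word_mats) (simp_all add: L_def mult.commute)
    then show ?thesis by (simp add: L_def algebra_simps)
  qed
  have one: "1 \<in> L" using rotate[OF omega] by (simp add: algebra_simps)
  have omega2: "- 1 - omega \<in> L" using rotate[OF one] by simp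
  have neg: "- 1 \<in> L" "- omega \<in> L"
    using add[OF omega omega2] add[OF one omega2] by simp_all
  have mult: "of_int a * y \<in> L" if "y \<in> L" "- y \<in> L" for a y
  proof (induction a rule: int_induct[of _ 0])
    case base
    show ?case by (simp add: zero)
  next
    case (step1 i)
    then show ?case using add[OF step1(2) that(1)] by (simp add: algebra_simps)
  next
    case (step2 i)
    then show ?case using add[OF step2(2) that(2)] by (simp add: algebra_simps)
  qed
  obtain a b where "x = of_int a + of_int b * omega"
    using assms by (rule eisensteinE)
  then have "x \<in> L"
    using add[OF mult[of 1 a] mult[of omega b]] one omega neg by simp
  then show ?thesis by (simp add: L_def)
qed

text \<open>
  Euclidean descent on the norm of the lower left entry \<open>c\<close>. If \<open>c = 0\<close>, the diagonal entries are
  units and the matrix is a translation times a diagonal matrix. Otherwise translating by an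
  Eisenstein integer \<open>q\<close> near \<open>a / c\<close> and inverting replaces \<open>c\<close> by \<open>q * c - a\<close>, of smaller norm.
\<close>

theorem SL2_eisenstein_generated:
  assumes "M \<in> carrier (SL2 eisenstein_ints)"
  shows "M \<in> even_word_mats"
proof -
  obtain n :: nat where "(cmod (M $ 2 $ 1))\<^sup>2 = of_nat n"
    using assms eisenstein_norm_nat by (metis (no_types, lifting) SL2_def mem_Collect_eq partial_object.select_convs(1))
  then show ?thesis
    using assms
  proof (induction n arbitrary: M rule: less_induct)
    case (less n)
    obtain a b c d where M: "M = mat2 a b c d" by (rule mat2_cases)
    have E: "a \<in> eisenstein_ints" "b \<in> eisenstein_ints" "c \<in> eisenstein_ints"
      "d \<in> eisenstein_ints" and det: "a * d - b * c = 1"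
      using less.prems(2) by (simp_all add: SL2_def M forall_2)
    show ?case
    proof (cases "c = 0")
      case True
      with det have ad: "a * d = 1" by simp
      have "mat2 1 (a * b) 0 1 ** mat2 a 0 0 d \<in> even_word_mats"
        using E ad by (intro even_word_mats_mult translation_in_even_word_mats
            diagonal_in_even_word_mats eisenstein_ints_closed)
      moreover have "mat2 1 (a * b) 0 1 ** mat2 a 0 0 d = M"
        using ad True by (simp add: M algebra_simps)
      ultimately show ?thesis by simp
    next
      case False
      obtain q where q: "q \<in> eisenstein_ints" "cmod (a / c - q) < 1"
        by (rule eisenstein_approximation)
      define N where "N = mat2 c d (q * c - a) (q * d - b)"
      have dE: "x - y \<in> eisenstein_ints" if "x \<in> eisenstein_ints" "y \<in> eisenstein_ints" for x y
        using eisenstein_ints_closed(4)[OF that(1) eisenstein_ints_closed(3)[OF that(2)]] by simp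
      have N: "N \<in> carrier (SL2 eisenstein_ints)"
        using E q det by (auto simp: SL2_def N_def forall_2 algebra_simps intro!: dE eisenstein_ints_closed)
      have "q * c - a \<in> eisenstein_ints" using E q by (intro dE eisenstein_ints_closed)
      then obtain m :: nat where m: "(cmod (q * c - a))\<^sup>2 = of_nat m"
        by (rule eisenstein_norm_nat)
      have "q * c - a = - (a / c - q) * c" using False by (simp add: field_simps)
      then have "cmod (q * c - a) = cmod (a / c - q) * cmod c"
        by (simp only: norm_mult norm_minus_cancel)
      also have "\<dots> < 1 * cmod c" using q(2) False by (intro mult_strict_right_mono) auto
      finally have "(cmod (q * c - a))\<^sup>2 < (cmod c)\<^sup>2" by (intro power_strict_mono) auto
      then have "m < n" using m less.prems(1) by (simp add: M)
      then have "N \<in> even_word_mats" using less.IH[of m N] m N by (simp add: N_def)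
      then have "mat2 1 q 0 1 ** mat2 0 (-1) 1 0 ** N \<in> even_word_mats"
        using q by (intro even_word_mats_mult translation_in_even_word_mats
            inversion_in_even_word_mats)
      moreover have "mat2 1 q 0 1 ** mat2 0 (-1) 1 0 ** N = M"
        by (simp add: M N_def algebra_simps)
      ultimately show ?thesis by simp
    qed
  qed
qed

section \<open>The isomorphism\<close>

lemma refl_mat_entries: "refl_mat i $ k $ l \<in> eisenstein_ints"
  using eisenstein_ints_closed(3)[OF omega_in_eisenstein]
    eisenstein_ints_closed(3)[OF eisenstein_ints_closed(2)]
    eisenstein_ints_closed(4)[of "-1" "- omega"]
    eisenstein_ints_closed(4)[of 1 omega] eisenstein_ints_closed(1,2) exhaust_2[of k] exhaust_2[of l]
  by (cases i) auto

lemma cnj_eisenstein: "x \<in> eisenstein_ints \<Longrightarrow> cnj x \<in> eisenstein_ints"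
proof (elim eisensteinE)
  fix a b assume x: "x = of_int a + of_int b * omega"
  have "cnj x = of_int (a - b) + of_int (- b) * omega" by (simp add: x algebra_simps)
  then show "cnj x \<in> eisenstein_ints" by (simp only: eisensteinI)
qed

lemma word_mat_entries: "word_mat u $ k $ l \<in> eisenstein_ints"
proof (induction u arbitrary: k l)
  case Nil
  show ?case by (simp add: mat_def eisenstein_ints_closed)
next
  case (Cons i u)
  then show ?case
    by (simp add: matrix_matrix_mult_def sum_2 conj_mat_def refl_mat_entries cnj_eisenstein
        eisenstein_ints_closed)
qed

lemma det_word_mat: "det (word_mat u) = (-1) ^ length u"
proof (induction u)
  case (Cons i u)
  have "det (refl_mat i) = -1" by (cases i) (simp_all add: algebra_simps)
  with Cons show ?case by (simp add: det_mul)
qed simp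

lemma word_mat_in_SL2: "even (length u) \<Longrightarrow> word_mat u \<in> carrier (SL2 eisenstein_ints)"
  by (simp add: SL2_def word_mat_entries det_word_mat)

lemma mult_PSL2:
  "{M, - M} \<otimes>\<^bsub>PSL2 R\<^esub> {N, - N} = {M ** N, - (M ** N)}"
  by (auto simp: PSL2_def FactGroup_def set_mult_def SL2_def)

text \<open>
  The inverse of a product of reflections is the reversed product, so two words with the same matrix
  up to sign give a word \<open>u @ rev v\<close> in the kernel.
\<close>

lemma word_mat_inj:
  assumes "even (length u)" "even (length v)" "word_mat u \<in> {word_mat v, - word_mat v}"
  shows "weyl_prod A2pp_cartan u = weyl_prod A2pp_cartan v"
proof -
  let ?W = "weyl_prod A2pp_cartan"
  have "word_mat (v @ rev v) \<in> {mat 1, - mat 1}"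
    using word_mat_weyl_prod[OF weyl_prod_rev[of A2pp_cartan "rev v"]] by simp
  then have "word_mat (u @ rev v) \<in> {mat 1, - mat 1}"
    using assms by (auto simp: word_mat_append)
  then have "?W (u @ rev v) = ?W []"
    using assms by (intro word_mat_kernel) auto
  from weyl_prod_cong[OF this, of "[]" v] have "?W (u @ rev v @ v) = ?W v" by simp
  moreover have "?W (u @ rev v @ v) = ?W u"
    using weyl_prod_cong[OF weyl_prod_rev[of A2pp_cartan v], of u "[]"] by simp
  ultimately show ?thesis by simp
qed

theorem proposition5:
  shows "even_weyl_group A2pp_cartan \<cong> PSL2 eisenstein_ints"
proof -
  let ?W = "weyl_prod A2pp_cartan"
  \<comment> \<open>The matrix of any even word for \<open>X\<close> will do; by \<open>word_mat_weyl_prod\<close> the class does not depend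
    on the chosen one.\<close>
  define rep where "rep X = (SOME u. even (length u) \<and> ?W u = X)" for X
  define \<phi> where "\<phi> X = {word_mat (rep X), - word_mat (rep X)}" for X
  have carrier: "carrier (even_weyl_group A2pp_cartan) = {?W u | u. even (length u)}"
    by (simp add: even_weyl_group_def)
  have phi: "\<phi> (?W u) = {word_mat u, - word_mat u}" if "even (length u)" for u
  proof -
    have "even (length (rep (?W u))) \<and> ?W (rep (?W u)) = ?W u"
      unfolding rep_def by (rule someI[of _ u]) (use that in simp)
    then have "word_mat (rep (?W u)) \<in> {word_mat u, - word_mat u}"
      by (intro word_mat_weyl_prod) simp
    then show ?thesis by (auto simp: \<phi>_def)
  qed
  have carrier_PSL: "carrier (PSL2 eisenstein_ints) = (\<lambda>M. {M, - M}) ` carrier (SL2 eisenstein_ints)"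
    by (intro carrier_PSL2 eisenstein_ints_closed)
  have "\<phi> \<in> hom (even_weyl_group A2pp_cartan) (PSL2 eisenstein_ints)"
  proof (rule homI)
    fix X assume "X \<in> carrier (even_weyl_group A2pp_cartan)"
    then show "\<phi> X \<in> carrier (PSL2 eisenstein_ints)"
      by (auto simp: carrier carrier_PSL phi intro!: imageI word_mat_in_SL2)
  next
    fix X Y
    assume "X \<in> carrier (even_weyl_group A2pp_cartan)" "Y \<in> carrier (even_weyl_group A2pp_cartan)"
    then obtain u v where uv: "X = ?W u" "Y = ?W v" "even (length u)" "even (length v)"
      by (auto simp: carrier)
    have "X \<otimes>\<^bsub>even_weyl_group A2pp_cartan\<^esub> Y = ?W (u @ v)"
      by (simp add: uv even_weyl_group_def weyl_prod_append)
    then show "\<phi> (X \<otimes>\<^bsub>even_weyl_group A2pp_cartan\<^esub> Y) = \<phi> X \<otimes>\<^bsub>PSL2 eisenstein_ints\<^esub> \<phi> Y"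
      using uv by (simp add: phi mult_PSL2 word_mat_append)
  qed
  moreover have "bij_betw \<phi> (carrier (even_weyl_group A2pp_cartan)) (carrier (PSL2 eisenstein_ints))"
  proof (rule bij_betw_imageI)
    show "inj_on \<phi> (carrier (even_weyl_group A2pp_cartan))"
    proof (rule inj_onI)
      fix X Y
      assume "X \<in> carrier (even_weyl_group A2pp_cartan)" "Y \<in> carrier (even_weyl_group A2pp_cartan)"
      then obtain u v where uv: "X = ?W u" "Y = ?W v" "even (length u)" "even (length v)"
        by (auto simp: carrier)
      assume "\<phi> X = \<phi> Y"
      then have "word_mat u \<in> {word_mat v, - word_mat v}" using uv phi by auto
      then show "X = Y" using uv word_mat_inj by blast
    qed
    show "\<phi> ` carrier (even_weyl_group A2pp_cartan) = carrier (PSL2 eisenstein_ints)"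
    proof
      show "\<phi> ` carrier (even_weyl_group A2pp_cartan) \<subseteq> carrier (PSL2 eisenstein_ints)"
        by (auto simp: carrier carrier_PSL phi intro!: imageI word_mat_in_SL2)
      show "carrier (PSL2 eisenstein_ints) \<subseteq> \<phi> ` carrier (even_weyl_group A2pp_cartan)"
      proof
        fix C assume "C \<in> carrier (PSL2 eisenstein_ints)"
        then obtain M where M: "C = {M, - M}" "M \<in> carrier (SL2 eisenstein_ints)"
          by (auto simp: carrier_PSL)
        then obtain u where u: "even (length u)" "M \<in> {word_mat u, - word_mat u}"
          using SL2_eisenstein_generated[of M] by (auto simp: even_word_mats_def)
        then have "C = \<phi> (?W u)" by (auto simp: M phi)
        with u show "C \<in> \<phi> ` carrier (even_weyl_group A2pp_cartan)"
          by (auto simp: carrier)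
      qed
    qed
  qed
  ultimately show ?thesis by (auto simp: is_iso_def iso_def)
qed

end
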